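(* For every countable ordinal $\alpha$, there is a separable Banach lattice with a countable $\pi$-basis that fails to be $\alpha$-Fatou.
   Context: For a Banach lattice $X$, $X^+=\{x\in X: x\geqslant 0\}$ and $u^+=u\vee 0$. "$\inf_n z_n=0$" means that $0$ is the greatest lower bound of $\{z_n\}$ in $X$. A countable $\pi$-basis for $X$ is a countable family $\{b_n\}_{n=1}^\infty$ of elements $b_n>0$ of $X$ such that for every $x\in X$ with $x>0$ there is some $n$ with $b_n\leqslant x$. Trees and rank. For a set $\Sigma$, $\Sigma^{<\mathbb N}$ is the set of all finite strings of elements of $\Sigma$. A tree is a subset $T\subseteq\Sigma^{<\mathbb N}$ containing the empty string $\emptyset$ and closed under initial segments. $T$ is ill-founded if there is an infinite sequence $(y_n)_{n=1}^\infty$ in $\Sigma$ with $(y_1,\ldots,y_n)\in T$ for all $n$; otherwise it is well-founded. For a well-founded tree $T$, $\rho_T(s)=0$ if $s\in T$ has no proper extension in $T$, and otherwise $\rho_T(s)=\sup\{\rho_T(t)+1: t\in T,\ s\subsetneq t\}$. The rank of $T$ is $\rho(T)=\rho_T(\emptyset)+1$. If $T$ is ill-founded, set $\rho(T)=\infty$, which is larger than every ordinal. Let $X_\downarrow=\{(z_n)_{n=1}^\infty\in X^{\mathbb N}: z_1\geqslant z_2\geqslant\ldots\geqslant 0\}$. For $(z_n)\in X_\downarrow$, let $\Psi((z_n))\subseteq (X^+\setminus\{0\})^{<\mathbb N}$ be the tree of all finite strings $(y_1,\ldots,y_k)$ such that $\|(y_i-z_n)^+\|\leqslant \|y_i\|/3^i$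 for all $1\leqslant i\leqslant k$ and all $n\geqslant 1$, and $\|y_{i+1}-y_i\|\leqslant \|y_i\|/3^i$ for all $1\leqslant i<k$. For an ordinal $\alpha$, a separable Banach lattice $X$ is $\alpha$-Fatou if for every $(z_n)\in X_\downarrow$: $\inf_n z_n=0$ if and only if $\rho(\Psi((z_n)))\leqslant\alpha$. *)

theory Defs
  imports
    "HOL-Algebra.Lattice"
    "HOL-Algebra.Module"
    "HOL-Library.Sublist"
    "HOL-Library.Extended"
    "HOL-Analysis.Analysis"
begin

section \<open>Ordinals\<close>

no_notation elt_set_eq (infix \<open>=o\<close> 50)
unbundle cardinal_syntax

text \<open>
  An ordinal is an isomorphism class of well-orders.  The type \<open>'b ordinal\<close> consists of the
  order types of all well-orders whose field is a set of elements of \<open>'b\<close>.  For infinite \<open>'b\<close>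
  these are exactly the ordinals below the cardinal successor of the cardinality of \<open>'b\<close>; in
  particular all countable ordinals are among them.
\<close>

quotient_type 'b ordinal = "'b rel" / partial: "\<lambda>r s. r =o s"
proof (rule part_equivpI)
  have "({}::'b rel) =o ({}::'b rel)" by (simp add: ordIso_reflexive)
  then show "\<exists>r::'b rel. r =o r" by blast
  show "symp (\<lambda>r s::'b rel. r =o s)" by (auto intro: sympI ordIso_symmetric)
  show "transp (\<lambda>r s::'b rel. r =o s)" by (auto intro: transpI ordIso_transitive)
qed

lemma ordIso_refl_iff: "r =o r \<longleftrightarrow> Well_order r"
  using ordIso_reflexive by (auto simp: ordIso_def)

instantiation ordinal :: (type) linorder
begin

lift_definition less_eq_ordinal :: "'a ordinal \<Rightarrow> 'a ordinal \<Rightarrow> bool" is "\<lambda>r s. r \<le>o s"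
  by (meson ordIso_ordLeq_trans ordIso_symmetric ordLeq_ordIso_trans)

lift_definition less_ordinal :: "'a ordinal \<Rightarrow> 'a ordinal \<Rightarrow> bool" is "\<lambda>r s. r <o s"
  by (meson ordIso_ordLess_trans ordIso_symmetric ordLess_ordIso_trans)

instance
proof
  fix x y z :: "'a ordinal"
  show "x < y \<longleftrightarrow> x \<le> y \<and> \<not> y \<le> x"
    by transfer (meson ordLess_imp_ordLeq not_ordLess_ordLeq not_ordLeq_iff_ordLess ordIso_refl_iff)
  show "x \<le> x" by transfer (simp add: ordLeq_reflexive ordIso_refl_iff)
  show "x \<le> y \<Longrightarrow> y \<le> z \<Longrightarrow> x \<le> z" by transfer (rule ordLeq_transitive)
  show "x \<le> y \<Longrightarrow> y \<le> x \<Longrightarrow> x = y" by transfer (simp add: ordIso_iff_ordLeq)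
  show "x \<le> y \<or> y \<le> x" by transfer (simp add: ordLeq_total ordIso_refl_iff)
qed

end

instance ordinal :: (type) wellorder
proof (rule wf_wellorderI)
  have "wf (inv_image ordLess (rep_ordinal :: 'a ordinal \<Rightarrow> 'a rel))"
    by (intro wf_inv_image wf_ordLess)
  moreover have "{(x, y). x < y} \<subseteq> inv_image ordLess (rep_ordinal :: 'a ordinal \<Rightarrow> 'a rel)"
    by (auto simp: less_ordinal.rep_eq)
  ultimately show "wf {(x::'a ordinal, y). x < y}" by (rule wf_subset)
qed intro_classes

instantiation ordinal :: (type) order_bot
begin

definition bot_ordinal :: "'a ordinal" where "bot_ordinal = (LEAST x. True)"

instance by standard (simp add: bot_ordinal_def Least_le)

end

instantiation ordinal :: (type) conditionally_complete_linorder
begin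

definition inf_ordinal :: "'a ordinal \<Rightarrow> 'a ordinal \<Rightarrow> 'a ordinal" where "inf_ordinal = min"
definition sup_ordinal :: "'a ordinal \<Rightarrow> 'a ordinal \<Rightarrow> 'a ordinal" where "sup_ordinal = max"
definition Inf_ordinal :: "'a ordinal set \<Rightarrow> 'a ordinal" where "Inf_ordinal A = (LEAST x. x \<in> A)"
definition Sup_ordinal :: "'a ordinal set \<Rightarrow> 'a ordinal" where "Sup_ordinal A = (LEAST x. \<forall>a\<in>A. a \<le> x)"

instance
proof
  fix x z :: "'a ordinal" and A :: "'a ordinal set"
  show "x \<in> A \<Longrightarrow> Inf A \<le> x" by (simp add: Inf_ordinal_def Least_le)
  show "z \<le> Inf A" if "A \<noteq> {}" "\<And>x. x \<in> A \<Longrightarrow> z \<le> x"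
    unfolding Inf_ordinal_def using that by (metis LeastI ex_in_conv)
  show "x \<le> Sup A" if "x \<in> A" "bdd_above A"
  proof -
    from \<open>bdd_above A\<close> obtain u where "\<forall>a\<in>A. a \<le> u" by (auto simp: bdd_above_def)
    then have "\<forall>a\<in>A. a \<le> Sup A" unfolding Sup_ordinal_def by (rule LeastI)
    with \<open>x \<in> A\<close> show ?thesis by blast
  qed
  show "Sup A \<le> z" if "\<And>x. x \<in> A \<Longrightarrow> x \<le> z"
    unfolding Sup_ordinal_def using that by (intro Least_le) blast
qed (auto simp: inf_ordinal_def sup_ordinal_def)

end

lemma Sup_ordinal_empty [simp]: "Sup {} = (bot :: 'b ordinal)"
  by (simp add: Sup_ordinal_def bot_ordinal_def)

definition ord_suc :: "'b ordinal \<Rightarrow> 'b ordinal"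
  where "ord_suc \<beta> = (LEAST \<gamma>. \<beta> < \<gamma>)"

text \<open>
  For infinite \<open>'b\<close>, successors and suprema of at most \<open>'b\<close>-many ordinals exist in \<open>'b ordinal\<close>,
  so \<^const>\<open>ord_suc\<close> and \<^const>\<open>Sup\<close> have their intended values there.
\<close>

definition initial_ord :: "'b rel \<Rightarrow> 'b \<Rightarrow> 'b ordinal"
  where "initial_ord r a = abs_ordinal (Restr r (underS r a))"

lemma initial_ord_image:
  assumes "Well_order r"
  shows "initial_ord r ` Field r = {..<abs_ordinal r}"
proof -
  have W: "Well_order (Restr r A)" for A using assms by (rule Well_order_Restr)
  have abs_less: "abs_ordinal s < abs_ordinal r \<longleftrightarrow> s <o r" if "Well_order s" for s
    using that assms by (intro less_ordinal.abs_eq) (simp_all add: ordIso_refl_iff)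
  show ?thesis
  proof (intro equalityI subsetI)
    fix \<beta> assume "\<beta> \<in> initial_ord r ` Field r"
    then show "\<beta> \<in> {..<abs_ordinal r}"
      using assms abs_less[OF W] by (auto simp: initial_ord_def intro: underS_Restr_ordLess)
  next
    fix \<beta> assume b: "\<beta> \<in> {..<abs_ordinal r}"
    define s where "s = rep_ordinal \<beta>"
    have s: "abs_ordinal s = \<beta>" "Well_order s"
      using Quotient_rep_reflp[OF Quotient_ordinal] Quotient_abs_rep[OF Quotient_ordinal]
      by (auto simp: s_def ordIso_refl_iff)
    from b s abs_less have "s <o r" by auto
    then obtain a where a: "a \<in> Field r" "s =o Restr r (underS r a)"
      using ordLess_iff_ordIso_Restr[OF assms s(2)] by blast
    have "abs_ordinal s = initial_ord r a"
      unfolding initial_ord_def using a(2) by (rule Quotient_rel_abs[OF Quotient_ordinal])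
    with a s show "\<beta> \<in> initial_ord r ` Field r" by auto
  qed
qed

lemma initial_ord_less:
  assumes "Well_order r" "(a, b) \<in> r" "a \<noteq> b"
  shows "initial_ord r a < initial_ord r b"
proof -
  have wo: "wo_rel r" using assms by (simp add: wo_rel_def)
  have "underS r a \<subset> underS r b"
    using assms wo_rel.TRANS[OF wo] wo_rel.ANTISYM[OF wo]
    unfolding underS_def trans_def antisym_def by blast
  then have "Restr r (underS r a) <o Restr r (underS r b)"
    using ofilter_subset_ordLess[OF assms(1)] wo_rel.underS_ofilter[OF wo] by blast
  then show ?thesis
    unfolding initial_ord_def
    by (subst less_ordinal.abs_eq) (simp_all add: ordIso_refl_iff Well_order_Restr assms(1))
qed

lemma ordinal_abs_exhaust: "\<exists>r. Well_order r \<and> abs_ordinal r = \<beta>"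
  using Quotient_rep_reflp[OF Quotient_ordinal] Quotient_abs_rep[OF Quotient_ordinal]
  by (metis ordIso_refl_iff)

lemma card_of_lessThan_ordinal: "|{..<\<beta> :: 'b ordinal}| \<le>o |UNIV :: 'b set|"
proof -
  obtain r where r: "Well_order r" "abs_ordinal r = \<beta>" using ordinal_abs_exhaust by blast
  have "|initial_ord r ` Field r| \<le>o |Field r|" by (rule card_of_image)
  also have "|Field r| \<le>o |UNIV :: 'b set|" by (simp add: card_of_mono1)
  finally show ?thesis using r initial_ord_image by metis
qed

lemma no_inj_ordinal: "\<not> inj (h :: 'b ordinal \<Rightarrow> 'b)"
proof
  assume h: "inj h"
  define R where "R = {(h \<alpha>, h \<beta>) | \<alpha> \<beta>. \<alpha> \<le> \<beta>}"
  have R_iff: "(h \<alpha>, h \<beta>) \<in> R \<longleftrightarrow> \<alpha> \<le> \<beta>" for \<alpha> \<beta>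
    using h by (auto simp: R_def inj_def)
  have FR: "Field R = range h"
    by (auto simp: R_def Field_def)
  have R_mem: "(x, y) \<in> R \<longleftrightarrow> x \<in> range h \<and> y \<in> range h \<and> inv_into UNIV h x \<le> inv_into UNIV h y" for x y
  proof (cases "x \<in> range h \<and> y \<in> range h")
    case True
    then show ?thesis using h R_iff by auto
  qed (auto simp: R_def)
  have "refl_on (range h) R" by (auto simp: refl_on_def R_mem)
  moreover have "trans R" by (auto simp: trans_def R_mem)
  moreover have "antisym R"
  proof (rule antisymI)
    fix x y assume "(x, y) \<in> R" "(y, x) \<in> R"
    then have "inv_into UNIV h x = inv_into UNIV h y" "x \<in> range h" "y \<in> range h"
      by (simp_all add: R_mem)
    then show "x = y" by (rule inv_into_injective)
  qed
  moreover have "total_on (range h) R" by (auto simp: total_on_def R_mem)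
  moreover have "R \<subseteq> range h \<times> range h" by (auto simp: R_def)
  ultimately have "Linear_order R"
    by (simp add: FR linear_order_on_def partial_order_on_def preorder_on_def)
  moreover have "wf (R - Id)"
  proof -
    have "R - Id \<subseteq> inv_image {(x, y). x < y} (inv_into UNIV h)"
      using h by (auto simp: R_def)
    moreover have "wf (inv_image {(x::'b ordinal, y). x < y} (inv_into UNIV h))"
      by (intro wf_inv_image) (rule wf)
    ultimately show ?thesis by (rule wf_subset[rotated])
  qed
  ultimately have WR: "Well_order R" by (simp add: well_order_on_def)
  have less: "\<beta> < abs_ordinal R" for \<beta>
  proof -
    obtain r where r: "Well_order r" "abs_ordinal r = \<beta>" using ordinal_abs_exhaust by blast
    have img: "(h \<circ> initial_ord r) ` Field r = h ` {..<\<beta>}"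
      unfolding image_comp[symmetric] initial_ord_image[OF r(1)] r(2) ..
    have less_if: "initial_ord r a < initial_ord r b \<or> initial_ord r b < initial_ord r a"
      if "a \<in> Field r" "b \<in> Field r" "a \<noteq> b" for a b
      using that r(1) initial_ord_less[OF r(1)]
      unfolding well_order_on_def linear_order_on_def total_on_def by metis
    have "compat r R (h \<circ> initial_ord r)"
      unfolding compat_def using initial_ord_less[OF r(1)] R_iff
      by (metis comp_apply order.refl order.strict_implies_order)
    moreover have "inj_on (h \<circ> initial_ord r) (Field r)"
      using h less_if by (auto simp: inj_on_def inj_def) (metis less_irrefl)
    moreover have "wo_rel.ofilter R ((h \<circ> initial_ord r) ` Field r)"
      unfolding img using WR R_iff FR
      by (auto simp: wo_rel.ofilter_def wo_rel_def under_def R_def inj_eq[OF h])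
    ultimately have "embed r R (h \<circ> initial_ord r)"
      using embed_iff_compat_inj_on_ofilter[OF r(1) WR] by blast
    moreover have "(h \<circ> initial_ord r) ` Field r \<noteq> Field R"
      unfolding img FR using h by (auto simp: inj_image_eq_iff)
    ultimately have "embedS r R (h \<circ> initial_ord r)"
      unfolding embedS_def bij_betw_def by blast
    then have "r <o R"
      unfolding ordLess_def using r(1) WR by blast
    then show ?thesis
      using r WR by (metis less_ordinal.abs_eq ordIso_refl_iff)
  qed
  show False using less[of "abs_ordinal R"] by simp
qed

lemma bdd_above_ordinal:
  fixes f :: "'b \<Rightarrow> 'b ordinal"
  assumes "infinite (UNIV :: 'b set)"
  shows "bdd_above (range f)"
proof (rule ccontr)
  assume "\<not> bdd_above (range f)"
  then have "(\<Union>x. {..<f x}) = UNIV"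
    by (auto simp: bdd_above_def not_le)
  moreover have "|\<Union>x. {..<f x}| \<le>o |UNIV :: 'b set|"
    using assms by (intro card_of_UNION_ordLeq_infinite) (simp_all add: card_of_lessThan_ordinal card_of_mono1)
  ultimately have "|UNIV :: 'b ordinal set| \<le>o |UNIV :: 'b set|" by simp
  then show False
    using no_inj_ordinal by (auto simp: card_of_ordLeq[symmetric])
qed

lemma less_ord_suc:
  fixes \<beta> :: "'b ordinal"
  assumes "infinite (UNIV :: 'b set)"
  shows "\<beta> < ord_suc \<beta>"
proof -
  have "\<exists>\<gamma>. \<beta> < \<gamma>"
  proof (rule ccontr)
    assume "\<not> ?thesis"
    then have U: "UNIV = insert \<beta> {..<\<beta>}" by (auto simp: not_less order_le_less)
    have "|{\<beta>} \<union> {..<\<beta>}| \<le>o |UNIV :: 'b set|"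
      using assms
      by (intro card_of_Un_ordLeq_infinite_Field card_of_lessThan_ordinal card_of_singl_ordLeq
          card_of_Card_order) (auto simp: Field_card_of)
    then have "|insert \<beta> {..<\<beta>}| \<le>o |UNIV :: 'b set|" by simp
    then show False
      unfolding U[symmetric] using no_inj_ordinal by (auto simp: card_of_ordLeq[symmetric])
  qed
  then show ?thesis unfolding ord_suc_def by (rule LeastI_ex)
qed

unbundle no cardinal_syntax


section \<open>Trees and rank\<close>

definition is_tree :: "'a list set \<Rightarrow> bool"
  where "is_tree T \<longleftrightarrow> [] \<in> T \<and> (\<forall>s t. t \<in> T \<and> prefix s t \<longrightarrow> s \<in> T)"

definition ill_founded :: "'a list set \<Rightarrow> bool"
  where "ill_founded T \<longleftrightarrow> (\<exists>y :: nat \<Rightarrow> 'a. \<forall>n. map y [0..<n] \<in> T)"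

definition extensions :: "'a list set \<Rightarrow> 'a list \<Rightarrow> 'a list set"
  where "extensions T s = {t \<in> T. strict_prefix s t}"

text \<open>
  The rank function is computed in \<open>'a list ordinal\<close>, which is large enough for every
  well-founded tree of strings over \<open>'a\<close>; its recursion equation is \<open>rank_at_eq\<close>.
\<close>

definition rank_at :: "'a list set \<Rightarrow> 'a list \<Rightarrow> 'a list ordinal"
  where "rank_at T = wfrec {(t, s). s \<in> T \<and> t \<in> extensions T s}
    (\<lambda>\<rho> s. if extensions T s = {} then bot else SUP t\<in>extensions T s. ord_suc (\<rho> t))"

text \<open>\<^const>\<open>Pinf\<close> plays the role of the value \<open>\<infinity>\<close>, which exceeds every ordinal.\<close>

definition tree_rank :: "'a list set \<Rightarrow> 'a list ordinal extended"
  where "tree_rank T = (if ill_founded T then Pinf else Fin (ord_suc (rank_at T [])))"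

lemma wf_extensions:
  assumes "is_tree T" "\<not> ill_founded T"
  shows "wf {(t, s). s \<in> T \<and> t \<in> extensions T s}"
proof (rule ccontr)
  assume "\<not> ?thesis"
  then obtain f where f: "\<And>i. f i \<in> T" "\<And>i. strict_prefix (f i) (f (Suc i))"
    unfolding wf_iff_no_infinite_down_chain by (auto simp: extensions_def)
  have len: "i \<le> length (f i)" for i
  proof (induction i)
    case (Suc i)
    with prefix_length_less[OF f(2)[of i]] show ?case by simp
  qed simp
  have pre: "prefix (f i) (f j)" if "i \<le> j" for i j
    using that by (induction j rule: dec_induct)
      (auto intro: prefix_order.trans prefix_order.less_imp_le[OF f(2)])
  define y where "y n = f (Suc n) ! n" for n
  have "map y [0..<n] = take n (f n)" for n
  proof (rule nth_equalityI)
    show "length (map y [0..<n]) = length (take n (f n))" using len[of n] by simp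
    fix i assume "i < length (map y [0..<n])"
    then have i: "i < n" by simp
    obtain zs where zs: "f n = f (Suc i) @ zs"
      using pre[of "Suc i" n] i by (auto simp: prefix_def)
    show "map y [0..<n] ! i = take n (f n) ! i"
      using i len[of "Suc i"] by (simp add: y_def zs nth_append)
  qed
  then have "map y [0..<n] \<in> T" for n
    using assms(1) f(1) take_is_prefix unfolding is_tree_def by metis
  with assms(2) show False by (auto simp: ill_founded_def)
qed

lemma rank_at_eq:
  assumes "is_tree T" "\<not> ill_founded T" "s \<in> T"
  shows "rank_at T s =
    (if extensions T s = {} then bot else SUP t\<in>extensions T s. ord_suc (rank_at T t))"
  unfolding rank_at_def
  by (subst wfrec[OF wf_extensions[OF assms(1,2)]])
    (use assms(3) in \<open>auto simp: cut_apply intro!: arg_cong[where f = Sup] image_cong\<close>)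

lemma bdd_above_rank: "bdd_above ((\<lambda>t. ord_suc (rank_at T t)) ` A)"
  by (rule bdd_above_mono[OF bdd_above_ordinal[OF infinite_UNIV_listI]]) auto


section \<open>Banach lattices\<close>

text \<open>
  The module record inherits (unused) multiplicative fields from \<^type>\<open>ring\<close>; only
  its carrier, addition, zero and scalar multiplication are relevant.  A separable normed space
  has at most continuum many elements, so every separable Banach lattice is isomorphic to one
  whose carrier is a set of real sequences.
\<close>

record 'a normed_lattice = "(real, 'a) module" +
  leq :: "'a \<Rightarrow> 'a \<Rightarrow> bool" (infix \<open>\<preceq>\<index>\<close> 50)
  nrm :: "'a \<Rightarrow> real" (\<open>\<parallel>_\<parallel>\<index>\<close> [0] 1000)

definition ord_of :: "('a, 'm) normed_lattice_scheme \<Rightarrow> 'a gorder"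
  where "ord_of X = \<lparr>carrier = carrier X, eq = (=), le = leq X\<rparr>"

definition vsup :: "('a, 'm) normed_lattice_scheme \<Rightarrow> 'a \<Rightarrow> 'a \<Rightarrow> 'a" (infixl \<open>\<curlyvee>\<index>\<close> 65)
  where "x \<curlyvee>\<^bsub>X\<^esub> y = join (ord_of X) x y"

definition vabs :: "('a, 'm) normed_lattice_scheme \<Rightarrow> 'a \<Rightarrow> 'a"
  where "vabs X x = x \<curlyvee>\<^bsub>X\<^esub> (\<ominus>\<^bsub>X\<^esub> x)"

definition pos_part :: "('a, 'm) normed_lattice_scheme \<Rightarrow> 'a \<Rightarrow> 'a"
  where "pos_part X x = x \<curlyvee>\<^bsub>X\<^esub> \<zero>\<^bsub>X\<^esub>"

definition ndist :: "('a, 'm) normed_lattice_scheme \<Rightarrow> 'a \<Rightarrow> 'a \<Rightarrow> real"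
  where "ndist X x y = \<parallel>x \<ominus>\<^bsub>X\<^esub> y\<parallel>\<^bsub>X\<^esub>"

definition real_ring :: "real ring"
  where "real_ring = \<lparr>carrier = UNIV, monoid.mult = (*), one = 1, zero = 0, add = (+)\<rparr>"

locale vector_lattice =
  fixes X :: "('a, 'm) normed_lattice_scheme" (structure)
  assumes real_vector_space: "Module.module real_ring X"
    and lattice_order: "Lattice.lattice (ord_of X)"
    and add_mono: "\<lbrakk>x \<in> carrier X; y \<in> carrier X; z \<in> carrier X; x \<preceq> y\<rbrakk> \<Longrightarrow> x \<oplus> z \<preceq> y \<oplus> z"
    and smult_mono: "\<lbrakk>x \<in> carrier X; y \<in> carrier X; x \<preceq> y; 0 \<le> c\<rbrakk> \<Longrightarrow> c \<odot> x \<preceq> c \<odot> y"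

locale banach_lattice = vector_lattice X
  for X :: "('a, 'm) normed_lattice_scheme" (structure) +
  assumes norm_nonneg: "x \<in> carrier X \<Longrightarrow> 0 \<le> \<parallel>x\<parallel>"
    and norm_eq_zero_iff: "x \<in> carrier X \<Longrightarrow> \<parallel>x\<parallel> = 0 \<longleftrightarrow> x = \<zero>"
    and norm_smult: "x \<in> carrier X \<Longrightarrow> \<parallel>c \<odot> x\<parallel> = \<bar>c\<bar> * \<parallel>x\<parallel>"
    and norm_triangle: "\<lbrakk>x \<in> carrier X; y \<in> carrier X\<rbrakk> \<Longrightarrow> \<parallel>x \<oplus> y\<parallel> \<le> \<parallel>x\<parallel> + \<parallel>y\<parallel>"
    and norm_lattice: "\<lbrakk>x \<in> carrier X; y \<in> carrier X; vabs X x \<preceq> vabs X y\<rbrakk> \<Longrightarrow> \<parallel>x\<parallel> \<le> \<parallel>y\<parallel>"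
    and complete: "Metric_space.mcomplete (carrier X) (ndist X)"

definition separable_banach_lattice :: "('a, 'm) normed_lattice_scheme \<Rightarrow> bool"
  where "separable_banach_lattice X \<longleftrightarrow>
    banach_lattice X \<and> separable_space (Metric_space.mtopology (carrier X) (ndist X))"

definition pos_cone :: "('a, 'm) normed_lattice_scheme \<Rightarrow> 'a set"
  where "pos_cone X = {x \<in> carrier X. \<zero>\<^bsub>X\<^esub> \<preceq>\<^bsub>X\<^esub> x}"

definition has_countable_pi_basis :: "('a, 'm) normed_lattice_scheme \<Rightarrow> bool"
  where "has_countable_pi_basis X \<longleftrightarrow>
    (\<exists>b :: nat \<Rightarrow> 'a. (\<forall>n. b n \<in> pos_cone X - {\<zero>\<^bsub>X\<^esub>}) \<and>
      (\<forall>x \<in> pos_cone X - {\<zero>\<^bsub>X\<^esub>}. \<exists>n. b n \<preceq>\<^bsub>X\<^esub> x))"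

definition decreasing_seqs :: "('a, 'm) normed_lattice_scheme \<Rightarrow> (nat \<Rightarrow> 'a) set"
  where "decreasing_seqs X = {z. \<forall>n. z n \<in> pos_cone X \<and> z (Suc n) \<preceq>\<^bsub>X\<^esub> z n}"

text \<open>
  Strings are 0-indexed lists: the entry \<open>y\<^sub>i\<close> with \<open>1 \<le> i \<le> k\<close> is \<open>ys ! (i - 1)\<close>.
\<close>

definition fatou_tree :: "('a, 'm) normed_lattice_scheme \<Rightarrow> (nat \<Rightarrow> 'a) \<Rightarrow> 'a list set"
  where "fatou_tree X z = {ys. set ys \<subseteq> pos_cone X - {\<zero>\<^bsub>X\<^esub>} \<and>
    (\<forall>i n. 1 \<le> i \<and> i \<le> length ys \<longrightarrow>
      \<parallel>pos_part X (ys ! (i - 1) \<ominus>\<^bsub>X\<^esub> z n)\<parallel>\<^bsub>X\<^esub> \<le> \<parallel>ys ! (i - 1)\<parallel>\<^bsub>X\<^esub> / 3 ^ i) \<and>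
    (\<forall>i. 1 \<le> i \<and> i < length ys \<longrightarrow>
      \<parallel>ys ! i \<ominus>\<^bsub>X\<^esub> ys ! (i - 1)\<parallel>\<^bsub>X\<^esub> \<le> \<parallel>ys ! (i - 1)\<parallel>\<^bsub>X\<^esub> / 3 ^ i)}"

lemma is_tree_fatou_tree: "is_tree (fatou_tree X z)"
  unfolding is_tree_def
proof (intro conjI allI impI)
  show "[] \<in> fatou_tree X z" by (simp add: fatou_tree_def)
  fix s t assume "t \<in> fatou_tree X z \<and> prefix s t"
  then obtain u where t: "t \<in> fatou_tree X z" "t = s @ u" by (auto simp: prefix_def)
  have nth: "t ! i = s ! i" if "i < length s" for i using that t(2) by (simp add: nth_append)
  have sub: "set s \<subseteq> set t" and len: "length s \<le> length t" using t(2) by auto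
  have "\<parallel>pos_part X (s ! (i - 1) \<ominus>\<^bsub>X\<^esub> z n)\<parallel>\<^bsub>X\<^esub> \<le> \<parallel>s ! (i - 1)\<parallel>\<^bsub>X\<^esub> / 3 ^ i"
    if "1 \<le> i" "i \<le> length s" for i n
  proof -
    have "t ! (i - 1) = s ! (i - 1)" "i \<le> length t" using that len by (auto intro: nth)
    with t(1) that show ?thesis unfolding fatou_tree_def mem_Collect_eq by metis
  qed
  moreover have "\<parallel>s ! i \<ominus>\<^bsub>X\<^esub> s ! (i - 1)\<parallel>\<^bsub>X\<^esub> \<le> \<parallel>s ! (i - 1)\<parallel>\<^bsub>X\<^esub> / 3 ^ i"
    if "1 \<le> i" "i < length s" for i
  proof -
    have "t ! i = s ! i" "t ! (i - 1) = s ! (i - 1)" "i < length t"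
      using that len by (auto intro: nth)
    with t(1) that show ?thesis unfolding fatou_tree_def mem_Collect_eq by metis
  qed
  moreover have "set s \<subseteq> pos_cone X - {\<zero>\<^bsub>X\<^esub>}"
    using t(1) sub unfolding fatou_tree_def by blast
  ultimately show "s \<in> fatou_tree X z"
    unfolding fatou_tree_def by blast
qed

definition alpha_fatou :: "'a list ordinal \<Rightarrow> ('a, 'm) normed_lattice_scheme \<Rightarrow> bool"
  where "alpha_fatou \<alpha> X \<longleftrightarrow> (\<forall>z \<in> decreasing_seqs X.
    greatest (ord_of X) \<zero>\<^bsub>X\<^esub> (Lower (ord_of X) (range z)) \<longleftrightarrow> tree_rank (fatou_tree X z) \<le> Fin \<alpha>)"

end

theory Submission
  imports Defs
begin

text \<open>
  Fix a countable ordinal \<open>\<alpha>\<close>.  The root of a well-founded tree of finite strings of naturals gets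
  the label \<open>\<alpha>\<close>; a node with label \<open>\<beta> > 0\<close> has infinitely many children, whose labels are below
  \<open>\<beta>\<close> and eventually reach or exceed every given ordinal below \<open>\<beta>\<close>; nodes with label \<open>0\<close> are leaves.  The
  lattice \<open>X\<close> consists of functions on the nodes, ordered pointwise, with norm
  \<open>sup 3\<^sup>-\<^sup>|\<^sup>t\<^sup>| |f(t)|\<close>.  It is the closed vector sublattice generated by countably many
  characteristic functions of sets of nodes, hence separable.  Each of these functions satisfies
  \<open>f(t n) \<rightarrow> f(t)\<close> along the children \<open>t n\<close> of an inner node \<open>t\<close>, and this passes to all of \<open>X\<close>
  (\<open>branch_limit\<close>).  Descending the tree, a function that is positive somewhere is therefore
  positive at a leaf (\<open>positive_at_leaf\<close>).  So the small multiples of the characteristic functions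
  of single leaves form a countable \<open>\<pi>\<close>-basis, and a decreasing sequence has infimum \<open>0\<close> as soon
  as it tends to \<open>0\<close> at every leaf.  Take for \<open>z n\<close> the characteristic function of all nodes but
  the leaves with code at most \<open>n\<close>.

  Strings of large rank come from decreasing sequences of ordinals \<open>\<alpha> > \<beta>\<^sub>1 > \<beta>\<^sub>2 > \<dots>\<close>.  Let
  \<open>y\<^sub>i\<close> be the characteristic function of the nodes whose initial segments of length \<open>j < i\<close>
  have labels above \<open>\<beta>\<^sub>j\<^sub>+\<^sub>1\<close>.  Leaves where \<open>y\<^sub>i\<close> lives have depth at least \<open>i\<close>, because their
  label \<open>0\<close> exceeds no ordinal; there \<open>y\<^sub>i - z n\<close> costs at most \<open>3\<^sup>-\<^sup>i\<close> in norm.  Likewise \<open>y\<^sub>i\<close> and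
  \<open>y\<^sub>i\<^sub>+\<^sub>1\<close> differ only at depth at least \<open>i\<close>.  As \<open>y\<^sub>i\<close> has norm at least \<open>1\<close>, the string belongs to
  \<open>\<Psi>((z n))\<close> (\<open>threshold_string_in_tree\<close>).  Since the sequence of ordinals may be continued by
  any ordinal below its last member, the rank at the string is at least that last member, and the
  rank at the empty string is at least \<open>\<alpha>\<close>; the rank of the tree then exceeds \<open>\<alpha>\<close>, although the
  infimum of the \<open>z n\<close> is \<open>0\<close>.
\<close>

section \<open>Function lattices with a weighted supremum norm\<close>

inductive_set lattice_span :: "('i \<Rightarrow> real) set \<Rightarrow> ('i \<Rightarrow> real) set" for G where
  zero: "(\<lambda>i. 0) \<in> lattice_span G"
| gen: "g \<in> G \<Longrightarrow> g \<in> lattice_span G"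
| add: "f \<in> lattice_span G \<Longrightarrow> g \<in> lattice_span G \<Longrightarrow> (\<lambda>i. f i + g i) \<in> lattice_span G"
| scale: "f \<in> lattice_span G \<Longrightarrow> (\<lambda>i. of_rat q * f i) \<in> lattice_span G"
| max: "f \<in> lattice_span G \<Longrightarrow> g \<in> lattice_span G \<Longrightarrow> (\<lambda>i. max (f i) (g i)) \<in> lattice_span G"

text \<open>
  Elements of the span are values of finite terms, of which there are only countably many.
\<close>

datatype lattice_term = ZeroT | GenT nat | AddT lattice_term lattice_term
  | ScaleT rat lattice_term | MaxT lattice_term lattice_term

instance lattice_term :: countable
  by countable_datatype

primrec term_value :: "(nat \<Rightarrow> 'i \<Rightarrow> real) \<Rightarrow> lattice_term \<Rightarrow> 'i \<Rightarrow> real" where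
  "term_value e ZeroT = (\<lambda>i. 0)"
| "term_value e (GenT n) = e n"
| "term_value e (AddT s t) = (\<lambda>i. term_value e s i + term_value e t i)"
| "term_value e (ScaleT q t) = (\<lambda>i. of_rat q * term_value e t i)"
| "term_value e (MaxT s t) = (\<lambda>i. max (term_value e s i) (term_value e t i))"

lemma countable_lattice_span:
  assumes "countable G"
  shows "countable (lattice_span G)"
proof -
  have "\<exists>t. f = term_value (from_nat_into G) t" if "f \<in> lattice_span G" for f
    using that
  proof induction
    case zero
    then show ?case by (metis term_value.simps(1))
  next
    case (gen g)
    then show ?case using assms by (metis from_nat_into_surj term_value.simps(2))
  next
    case (add f g)
    then show ?case by (metis term_value.simps(3))
  next
    case (scale f q)
    then show ?case by (metis term_value.simps(4))
  next
    case (max f g)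
    then show ?case by (metis term_value.simps(5))
  qed
  then have "lattice_span G \<subseteq> range (term_value (from_nat_into G))" by blast
  then show ?thesis by (rule countable_subset) simp
qed

text \<open>
  Indices of weight \<open>0\<close> are to be ignored; requiring the functions to vanish there makes the
  weighted seminorm a norm.
\<close>

definition closed_span :: "('i \<Rightarrow> real) \<Rightarrow> ('i \<Rightarrow> real) set \<Rightarrow> ('i \<Rightarrow> real) set" where
  "closed_span w G = {f. (\<forall>i. w i = 0 \<longrightarrow> f i = 0) \<and>
    (\<forall>e>0. \<exists>g\<in>lattice_span G. \<forall>i. w i * \<bar>f i - g i\<bar> \<le> e)}"

definition sup_norm :: "('i \<Rightarrow> real) \<Rightarrow> ('i \<Rightarrow> real) \<Rightarrow> real" where
  "sup_norm w f = (SUP i. w i * \<bar>f i\<bar>)"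

text \<open>
  Addition in the lattice first retracts its arguments to the carrier.  This makes the difference
  of arbitrary functions lie in the carrier, so that the induced distance is symmetric and
  nonnegative everywhere, as \<^locale>\<open>Metric_space\<close> demands of arguments outside the carrier too.
\<close>

definition retract :: "('i \<Rightarrow> real) \<Rightarrow> ('i \<Rightarrow> real) set \<Rightarrow> ('i \<Rightarrow> real) \<Rightarrow> 'i \<Rightarrow> real" where
  "retract w G f = (if f \<in> closed_span w G then f else (\<lambda>i. 0))"

definition span_lattice :: "('i \<Rightarrow> real) \<Rightarrow> ('i \<Rightarrow> real) set \<Rightarrow> ('i \<Rightarrow> real) normed_lattice" where
  "span_lattice w G = \<lparr>carrier = closed_span w G, monoid.mult = undefined, one = undefined,
    zero = (\<lambda>i. 0), add = (\<lambda>f g i. retract w G f i + retract w G g i), module.smult = (\<lambda>c f i. c * f i),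
    leq = (\<lambda>f g. \<forall>i. f i \<le> g i), nrm = sup_norm w\<rparr>"

lemma span_lattice_simps [simp]:
  "carrier (span_lattice w G) = closed_span w G"
  "\<zero>\<^bsub>span_lattice w G\<^esub> = (\<lambda>i. 0)"
  "f \<oplus>\<^bsub>span_lattice w G\<^esub> g = (\<lambda>i. retract w G f i + retract w G g i)"
  "c \<odot>\<^bsub>span_lattice w G\<^esub> f = (\<lambda>i. c * f i)"
  "f \<preceq>\<^bsub>span_lattice w G\<^esub> g \<longleftrightarrow> (\<forall>i. f i \<le> g i)"
  "\<parallel>f\<parallel>\<^bsub>span_lattice w G\<^esub> = sup_norm w f"
  "carrier (ord_of (span_lattice w G)) = closed_span w G"
  "f \<sqsubseteq>\<^bsub>ord_of (span_lattice w G)\<^esub> g \<longleftrightarrow> (\<forall>i. f i \<le> g i)"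
  "f .=\<^bsub>ord_of (span_lattice w G)\<^esub> g \<longleftrightarrow> f = g"
  by (simp_all add: span_lattice_def ord_of_def)

lemma retract_id [simp]: "f \<in> closed_span w G \<Longrightarrow> retract w G f = f"
  by (simp add: retract_def)

locale weighted_generators =
  fixes w :: "'i \<Rightarrow> real" and G :: "('i \<Rightarrow> real) set"
  assumes weight_nonneg: "0 \<le> w i"
    and generators_countable: "countable G"
    and generator_off_weight: "g \<in> G \<Longrightarrow> w i = 0 \<Longrightarrow> g i = 0"
    and generator_bounded: "g \<in> G \<Longrightarrow> \<exists>C. \<forall>i. w i * \<bar>g i\<bar> \<le> C"
begin

abbreviation "V \<equiv> closed_span w G"
abbreviation "X \<equiv> span_lattice w G"

lemma lattice_span_off_weight:
  assumes "g \<in> lattice_span G" "w i = 0"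
  shows "g i = 0"
  using assms by induction (auto simp: generator_off_weight)

lemma lattice_span_bounded:
  assumes "g \<in> lattice_span G"
  shows "\<exists>C. \<forall>i. w i * \<bar>g i\<bar> \<le> C"
  using assms
proof induction
  case zero
  then show ?case by auto
next
  case (gen g)
  then show ?case by (rule generator_bounded)
next
  case (add f g)
  then obtain C D where C: "\<And>i. w i * \<bar>f i\<bar> \<le> C" "\<And>i. w i * \<bar>g i\<bar> \<le> D" by blast
  have "w i * \<bar>f i + g i\<bar> \<le> C + D" for i
  proof -
    have "w i * \<bar>f i + g i\<bar> \<le> w i * (\<bar>f i\<bar> + \<bar>g i\<bar>)"
      by (intro mult_left_mono weight_nonneg) simp
    then show ?thesis using C(1)[of i] C(2)[of i] by (simp add: distrib_left)
  qed
  then show ?case by blast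
next
  case (scale f q)
  then obtain C where C: "\<And>i. w i * \<bar>f i\<bar> \<le> C" by blast
  have "w i * \<bar>of_rat q * f i\<bar> \<le> \<bar>of_rat q\<bar> * C" for i
    using mult_left_mono[OF C[of i], of "\<bar>of_rat q\<bar>"] by (simp add: abs_mult mult.left_commute)
  then show ?case by blast
next
  case (max f g)
  then obtain C D where C: "\<And>i. w i * \<bar>f i\<bar> \<le> C" "\<And>i. w i * \<bar>g i\<bar> \<le> D" by blast
  have "w i * \<bar>max (f i) (g i)\<bar> \<le> max C D" for i
    using C[of i] by (auto simp: max_def intro: order_trans)
  then show ?case by blast
qed

lemma lattice_span_subset: "lattice_span G \<subseteq> V"
proof
  fix f assume f: "f \<in> lattice_span G"
  have "\<forall>i. w i * \<bar>f i - f i\<bar> \<le> e" if "e > 0" for e :: real using that by simp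
  with f show "f \<in> V" unfolding closed_span_def using lattice_span_off_weight by blast
qed

lemma off_weight: "f \<in> V \<Longrightarrow> w i = 0 \<Longrightarrow> f i = 0"
  by (simp add: closed_span_def)

lemma approximable:
  assumes "f \<in> V" "e > 0"
  obtains g where "g \<in> lattice_span G" "\<And>i. w i * \<bar>f i - g i\<bar> \<le> e"
  using assms by (auto simp: closed_span_def)

lemma bounded:
  assumes "f \<in> V"
  shows "bdd_above (range (\<lambda>i. w i * \<bar>f i\<bar>))"
proof -
  obtain g where g: "g \<in> lattice_span G" "\<And>i. w i * \<bar>f i - g i\<bar> \<le> 1"
    using approximable[OF assms, of 1] by auto
  obtain C where C: "\<And>i. w i * \<bar>g i\<bar> \<le> C" using lattice_span_bounded[OF g(1)] by blast
  have "w i * \<bar>f i\<bar> \<le> 1 + C" for i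
  proof -
    have "w i * \<bar>f i\<bar> \<le> w i * (\<bar>f i - g i\<bar> + \<bar>g i\<bar>)"
      by (intro mult_left_mono weight_nonneg) simp
    then show ?thesis using g(2)[of i] C[of i] by (simp add: distrib_left)
  qed
  then show ?thesis by (auto simp: bdd_above_def)
qed

lemma weighted_le_norm: "f \<in> V \<Longrightarrow> w i * \<bar>f i\<bar> \<le> sup_norm w f"
  unfolding sup_norm_def by (intro cSUP_upper bounded) auto

lemma norm_le_iff: "f \<in> V \<Longrightarrow> sup_norm w f \<le> C \<longleftrightarrow> (\<forall>i. w i * \<bar>f i\<bar> \<le> C)"
  unfolding sup_norm_def by (subst cSUP_le_iff) (auto intro: bounded)

lemma add_in_V:
  assumes "f \<in> V" "g \<in> V"
  shows "(\<lambda>i. f i + g i) \<in> V"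
  unfolding closed_span_def
proof (intro CollectI conjI allI impI)
  fix i assume "w i = 0"
  then show "f i + g i = 0" using assms by (simp add: off_weight)
next
  fix e :: real assume "e > 0"
  then have "e / 2 > 0" by simp
  from approximable[OF assms(1) this] obtain f'
    where f': "f' \<in> lattice_span G" "\<And>i. w i * \<bar>f i - f' i\<bar> \<le> e / 2" by blast
  from approximable[OF assms(2) \<open>e / 2 > 0\<close>] obtain g'
    where g': "g' \<in> lattice_span G" "\<And>i. w i * \<bar>g i - g' i\<bar> \<le> e / 2" by blast
  have "w i * \<bar>f i + g i - (f' i + g' i)\<bar> \<le> e" for i
  proof -
    have "w i * \<bar>f i + g i - (f' i + g' i)\<bar> \<le> w i * (\<bar>f i - f' i\<bar> + \<bar>g i - g' i\<bar>)"
      by (intro mult_left_mono weight_nonneg) simp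
    then show ?thesis using f'(2)[of i] g'(2)[of i] by (simp add: distrib_left)
  qed
  with lattice_span.add[OF f'(1) g'(1)]
  show "\<exists>h\<in>lattice_span G. \<forall>i. w i * \<bar>f i + g i - h i\<bar> \<le> e" by (intro bexI) auto
qed

lemma max_in_V:
  assumes "f \<in> V" "g \<in> V"
  shows "(\<lambda>i. max (f i) (g i)) \<in> V"
  unfolding closed_span_def
proof (intro CollectI conjI allI impI)
  fix i assume "w i = 0"
  then show "max (f i) (g i) = 0" using assms by (simp add: off_weight)
next
  fix e :: real assume "e > 0"
  from approximable[OF assms(1) this] obtain f'
    where f': "f' \<in> lattice_span G" "\<And>i. w i * \<bar>f i - f' i\<bar> \<le> e" by blast
  from approximable[OF assms(2) \<open>e > 0\<close>] obtain g'
    where g': "g' \<in> lattice_span G" "\<And>i. w i * \<bar>g i - g' i\<bar> \<le> e" by blast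
  have "w i * \<bar>max (f i) (g i) - max (f' i) (g' i)\<bar> \<le> e" for i
  proof -
    have "\<bar>max (f i) (g i) - max (f' i) (g' i)\<bar> \<le> max \<bar>f i - f' i\<bar> \<bar>g i - g' i\<bar>"
      by (auto simp: max_def)
    then have "w i * \<bar>max (f i) (g i) - max (f' i) (g' i)\<bar>
        \<le> w i * max \<bar>f i - f' i\<bar> \<bar>g i - g' i\<bar>"
      by (intro mult_left_mono weight_nonneg)
    also have "\<dots> \<le> e" using f'(2)[of i] g'(2)[of i] by (auto simp: max_def)
    finally show ?thesis .
  qed
  with lattice_span.max[OF f'(1) g'(1)]
  show "\<exists>h\<in>lattice_span G. \<forall>i. w i * \<bar>max (f i) (g i) - h i\<bar> \<le> e" by (intro bexI) auto
qed

lemma uniform_limit_in_V: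
  assumes "\<And>i. w i = 0 \<Longrightarrow> f i = 0"
    and "\<And>e. e > 0 \<Longrightarrow> \<exists>g\<in>V. \<forall>i. w i * \<bar>f i - g i\<bar> \<le> e"
  shows "f \<in> V"
  unfolding closed_span_def
proof (intro CollectI conjI allI impI)
  fix e :: real assume "e > 0"
  then have e: "e / 2 > 0" by simp
  from assms(2)[OF this] obtain g where g: "g \<in> V" "\<And>i. w i * \<bar>f i - g i\<bar> \<le> e / 2" by blast
  from approximable[OF g(1) e] obtain h
    where h: "h \<in> lattice_span G" "\<And>i. w i * \<bar>g i - h i\<bar> \<le> e / 2" by blast
  have "w i * \<bar>f i - h i\<bar> \<le> e" for i
  proof -
    have "w i * \<bar>f i - h i\<bar> \<le> w i * (\<bar>f i - g i\<bar> + \<bar>g i - h i\<bar>)"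
      by (intro mult_left_mono weight_nonneg) simp
    then show ?thesis using g(2)[of i] h(2)[of i] by (simp add: distrib_left)
  qed
  with h show "\<exists>h\<in>lattice_span G. \<forall>i. w i * \<bar>f i - h i\<bar> \<le> e" by blast
qed (use assms in auto)

text \<open>
  The span is closed only under rational scaling; a real factor is reached by a uniform limit,
  because each element is bounded in the weighted sense.
\<close>

lemma scale_in_V:
  assumes f: "f \<in> V"
  shows "(\<lambda>i. c * f i) \<in> V"
proof (rule uniform_limit_in_V)
  show "w i = 0 \<Longrightarrow> c * f i = 0" for i using f by (simp add: off_weight)
  have rational: "(\<lambda>i. of_rat q * f i) \<in> V" for q
  proof (rule uniform_limit_in_V)
    show "w i = 0 \<Longrightarrow> of_rat q * f i = 0" for i using f by (simp add: off_weight)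
    fix e :: real assume e: "e > 0"
    define e' where "e' = e / (\<bar>of_rat q\<bar> + 1)"
    have "e' > 0" using e by (simp add: e'_def add_nonneg_pos)
    from approximable[OF f this] obtain g
      where g: "g \<in> lattice_span G" "\<And>i. w i * \<bar>f i - g i\<bar> \<le> e'" by blast
    have "w i * \<bar>of_rat q * f i - of_rat q * g i\<bar> \<le> e" for i
    proof -
      have "w i * \<bar>of_rat q * f i - of_rat q * g i\<bar> = \<bar>of_rat q\<bar> * (w i * \<bar>f i - g i\<bar>)"
        by (simp add: abs_mult flip: right_diff_distrib)
      also have "\<dots> \<le> (\<bar>of_rat q\<bar> + 1) * e'"
        using g(2)[of i] weight_nonneg[of i] by (intro mult_mono) auto
      also have "\<dots> = e" by (simp add: e'_def add_nonneg_pos[THEN less_imp_neq[THEN not_sym]])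
      finally show ?thesis .
    qed
    with subsetD[OF lattice_span_subset lattice_span.scale[OF g(1), of q]]
    show "\<exists>h\<in>V. \<forall>i. w i * \<bar>of_rat q * f i - h i\<bar> \<le> e" by (intro bexI) auto
  qed
  fix e :: real assume e: "e > 0"
  obtain C where C: "\<And>i. w i * \<bar>f i\<bar> \<le> C" using bounded[OF f] by (auto simp: bdd_above_def)
  define d where "d = e / (\<bar>C\<bar> + 1)"
  have d: "d > 0" using e by (simp add: d_def add_nonneg_pos)
  obtain q where q: "c - d < real_of_rat q" "real_of_rat q < c + d"
    using of_rat_dense[of "c - d" "c + d"] d by auto
  have "w i * \<bar>c * f i - of_rat q * f i\<bar> \<le> e" for i
  proof -
    have "w i * \<bar>c * f i - of_rat q * f i\<bar> = \<bar>c - of_rat q\<bar> * (w i * \<bar>f i\<bar>)"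
      by (simp add: abs_mult flip: left_diff_distrib)
    also have "\<dots> \<le> d * (\<bar>C\<bar> + 1)"
      using q C[of i] d weight_nonneg[of i] by (intro mult_mono) auto
    also have "\<dots> = e" by (simp add: d_def add_nonneg_pos[THEN less_imp_neq[THEN not_sym]])
    finally show ?thesis .
  qed
  with rational[of q] show "\<exists>g\<in>V. \<forall>i. w i * \<bar>c * f i - g i\<bar> \<le> e" by (intro bexI) auto
qed

lemma zero_in_V: "(\<lambda>i. 0) \<in> V"
  using lattice_span.zero lattice_span_subset by blast

lemma uminus_in_V: "f \<in> V \<Longrightarrow> (\<lambda>i. - f i) \<in> V"
  using scale_in_V[of f "- 1"] by simp

lemma diff_in_V: "f \<in> V \<Longrightarrow> g \<in> V \<Longrightarrow> (\<lambda>i. f i - g i) \<in> V"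
  using add_in_V[OF _ uminus_in_V] by simp

lemma min_in_V: "f \<in> V \<Longrightarrow> g \<in> V \<Longrightarrow> (\<lambda>i. min (f i) (g i)) \<in> V"
  using uminus_in_V[OF max_in_V[OF uminus_in_V uminus_in_V], of f g]
  by (simp only: minus_max_eq_min minus_minus)

lemma abelian_group_X: "abelian_group X"
proof (rule abelian_groupI)
  fix f assume "f \<in> carrier X"
  then show "\<exists>g\<in>carrier X. g \<oplus>\<^bsub>X\<^esub> f = \<zero>\<^bsub>X\<^esub>"
    using uminus_in_V by (intro bexI[of _ "\<lambda>i. - f i"]) auto
qed (auto simp: zero_in_V add_in_V algebra_simps)

lemma retract_in_V: "retract w G f \<in> V"
  by (simp add: retract_def zero_in_V)

text \<open>
  The retraction turns the negative of a function outside the carrier into \<open>0\<close>: the zero function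
  is the only element of the carrier whose sum with it is zero.
\<close>

lemma uminus_X: "\<ominus>\<^bsub>X\<^esub> f = (\<lambda>i. - retract w G f i)"
proof -
  have "\<ominus>\<^bsub>X\<^esub> f = (THE g. g \<in> V \<and> (\<lambda>i. retract w G f i + retract w G g i) = (\<lambda>i. 0)
      \<and> (\<lambda>i. retract w G g i + retract w G f i) = (\<lambda>i. 0))"
    unfolding a_inv_def m_inv_def by simp
  also have "\<dots> = (\<lambda>i. - retract w G f i)"
    using uminus_in_V[OF retract_in_V] by (intro the_equality) (auto simp: fun_eq_iff add_eq_0_iff)
  finally show ?thesis .
qed

lemma minus_X: "f \<ominus>\<^bsub>X\<^esub> g = (\<lambda>i. retract w G f i - retract w G g i)"
  using uminus_in_V[OF retract_in_V] by (simp add: a_minus_def uminus_X)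

lemma least_max:
  assumes "f \<in> V" "g \<in> V"
  shows "least (ord_of X) (\<lambda>i. max (f i) (g i)) (Upper (ord_of X) {f, g})"
  using assms max_in_V by (auto simp: least_def Upper_def)

lemma greatest_min:
  assumes "f \<in> V" "g \<in> V"
  shows "greatest (ord_of X) (\<lambda>i. min (f i) (g i)) (Lower (ord_of X) {f, g})"
  using assms min_in_V by (auto simp: greatest_def Lower_def)

lemma partial_order_X: "partial_order (ord_of X)"
  by unfold_locales (auto simp: ord_of_def fun_eq_iff intro: antisym order_trans)

lemma lattice_X: "Lattice.lattice (ord_of X)"
proof -
  interpret partial_order "ord_of X" by (rule partial_order_X)
  show ?thesis
    by unfold_locales (use least_max greatest_min in fastforce)+
qed

lemma sup_X [simp]:
  assumes "f \<in> V" "g \<in> V"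
  shows "f \<curlyvee>\<^bsub>X\<^esub> g = (\<lambda>i. max (f i) (g i))"
proof -
  have "f \<curlyvee>\<^bsub>X\<^esub> g = (SOME x. least (ord_of X) x (Upper (ord_of X) {f, g}))"
    by (simp add: vsup_def join_def Lattice.sup_def)
  also have "\<dots> = (\<lambda>i. max (f i) (g i))"
    using least_max[OF assms] partial_order.least_unique[OF partial_order_X]
    by (intro some_equality) auto
  finally show ?thesis .
qed

lemma abs_X [simp]: "f \<in> V \<Longrightarrow> vabs X f = (\<lambda>i. \<bar>f i\<bar>)"
  by (simp add: vabs_def uminus_X uminus_in_V fun_eq_iff) (auto simp: max_def)

lemma pos_part_X [simp]: "f \<in> V \<Longrightarrow> pos_part X f = (\<lambda>i. max (f i) 0)"
  by (simp add: pos_part_def zero_in_V)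

lemma module_X: "Module.module real_ring X"
proof (rule moduleI)
  have "abelian_group real_ring"
    by (rule abelian_groupI) (auto simp: real_ring_def intro: exI[of _ "- x" for x])
  moreover have "Group.comm_monoid real_ring"
    by (rule comm_monoidI) (auto simp: real_ring_def)
  ultimately show "cring real_ring"
    by (rule cringI) (auto simp: real_ring_def algebra_simps)
qed (auto simp: abelian_group_X scale_in_V real_ring_def algebra_simps)

lemma vector_lattice_X: "vector_lattice X"
  by (rule vector_lattice.intro) (auto simp: module_X lattice_X intro: mult_left_mono)

lemma norm_zero_iff:
  assumes "f \<in> V"
  shows "sup_norm w f = 0 \<longleftrightarrow> f = (\<lambda>i. 0)"
proof
  assume "sup_norm w f = 0"
  then have "w i * \<bar>f i\<bar> \<le> 0" for i using weighted_le_norm[OF assms] by metis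
  then have "w i = 0 \<or> f i = 0" for i
    using weight_nonneg[of i] by (metis abs_ge_zero abs_zero antisym mult_eq_0_iff mult_nonneg_nonneg abs_eq_0)
  then show "f = (\<lambda>i. 0)" using off_weight[OF assms] by blast
qed (simp add: sup_norm_def)

lemma norm_ge_0:
  assumes "f \<in> V"
  shows "0 \<le> sup_norm w f"
  using weighted_le_norm[OF assms] weight_nonneg by (meson abs_ge_zero mult_nonneg_nonneg order_trans)

lemma norm_scale:
  assumes "f \<in> V"
  shows "sup_norm w (\<lambda>i. c * f i) = \<bar>c\<bar> * sup_norm w f"
proof (rule antisym)
  show "sup_norm w (\<lambda>i. c * f i) \<le> \<bar>c\<bar> * sup_norm w f"
    using mult_left_mono[OF weighted_le_norm[OF assms], of "\<bar>c\<bar>"]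
    by (subst norm_le_iff) (auto simp: scale_in_V assms abs_mult mult.left_commute)
  show "\<bar>c\<bar> * sup_norm w f \<le> sup_norm w (\<lambda>i. c * f i)"
  proof (cases "c = 0")
    case False
    have "sup_norm w f \<le> sup_norm w (\<lambda>i. c * f i) / \<bar>c\<bar>"
      using weighted_le_norm[OF scale_in_V[OF assms, of c]] False
      by (subst norm_le_iff) (auto simp: assms abs_mult mult.left_commute field_simps)
    then show ?thesis using False by (simp add: field_simps)
  qed (simp add: sup_norm_def)
qed

lemma norm_add:
  assumes "f \<in> V" "g \<in> V"
  shows "sup_norm w (\<lambda>i. f i + g i) \<le> sup_norm w f + sup_norm w g"
proof (subst norm_le_iff[OF add_in_V[OF assms]], rule allI)
  fix i
  have "w i * \<bar>f i + g i\<bar> \<le> w i * (\<bar>f i\<bar> + \<bar>g i\<bar>)"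
    by (intro mult_left_mono weight_nonneg) simp
  then show "w i * \<bar>f i + g i\<bar> \<le> sup_norm w f + sup_norm w g"
    using weighted_le_norm[OF assms(1), of i] weighted_le_norm[OF assms(2), of i]
    by (simp add: distrib_left)
qed

lemma norm_mono:
  assumes "f \<in> V" "g \<in> V" "\<And>i. \<bar>f i\<bar> \<le> \<bar>g i\<bar>"
  shows "sup_norm w f \<le> sup_norm w g"
  unfolding norm_le_iff[OF assms(1)]
  using weighted_le_norm[OF assms(2)] assms(3) weight_nonneg by (meson mult_left_mono order_trans)

lemma ndist_X: "ndist X f g = sup_norm w (\<lambda>i. retract w G f i - retract w G g i)"
  by (simp add: ndist_def minus_X)

lemma metric_space_X: "Metric_space V (ndist X)"
proof
  fix f g h
  show "0 \<le> ndist X f g"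
    unfolding ndist_X by (intro norm_ge_0 diff_in_V retract_in_V)
  show "ndist X f g = ndist X g f"
    unfolding ndist_X by (simp add: sup_norm_def abs_minus_commute)
  assume fg: "f \<in> V" "g \<in> V"
  show "ndist X f g = 0 \<longleftrightarrow> f = g"
    using fg norm_zero_iff[OF diff_in_V[OF fg]] by (simp add: ndist_X fun_eq_iff)
  assume h: "h \<in> V"
  show "ndist X f h \<le> ndist X f g + ndist X g h"
    using norm_add[OF diff_in_V[OF fg] diff_in_V[OF fg(2) h]] fg h by (simp add: ndist_X)
qed

interpretation M: Metric_space V "ndist X"
  by (rule metric_space_X)

text \<open>
  A Cauchy sequence converges at each index of positive weight; the pointwise limit is a weighted
  uniform limit, and the closed span contains such limits.
\<close>

lemma mcomplete_X: "M.mcomplete"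
  unfolding M.mcomplete_def
proof (intro allI impI)
  fix \<sigma> assume "M.MCauchy \<sigma>"
  then have \<sigma>: "\<sigma> n \<in> V" for n by (auto simp: M.MCauchy_def)
  have Cauchy: "\<exists>N. \<forall>m\<ge>N. \<forall>n\<ge>N. \<forall>i. w i * \<bar>\<sigma> m i - \<sigma> n i\<bar> < e" if "e > 0" for e
  proof -
    from \<open>M.MCauchy \<sigma>\<close> that obtain N
      where "\<And>m n. N \<le> m \<Longrightarrow> N \<le> n \<Longrightarrow> ndist X (\<sigma> m) (\<sigma> n) < e"
      unfolding M.MCauchy_def by blast
    then have N: "sup_norm w (\<lambda>i. \<sigma> m i - \<sigma> n i) < e" if "N \<le> m" "N \<le> n" for m n
      using that \<sigma> by (simp add: ndist_X)
    have "w i * \<bar>\<sigma> m i - \<sigma> n i\<bar> < e" if "N \<le> m" "N \<le> n" for m n i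
      using weighted_le_norm[OF diff_in_V[OF \<sigma> \<sigma>], of i m n] N[OF that] by simp
    then show ?thesis by blast
  qed
  define F where "F i = lim (\<lambda>n. \<sigma> n i)" for i
  have lim: "(\<lambda>n. \<sigma> n i) \<longlonglongrightarrow> F i" for i
  proof (cases "w i = 0")
    case True
    then show ?thesis using off_weight[OF \<sigma>] by (simp add: F_def)
  next
    case False
    then have w: "w i > 0" using weight_nonneg[of i] by simp
    have "Cauchy (\<lambda>n. \<sigma> n i)"
    proof (rule metric_CauchyI)
      fix e :: real assume "e > 0"
      then have "w i * e > 0" using w by simp
      from Cauchy[OF this] w
      show "\<exists>N. \<forall>m\<ge>N. \<forall>n\<ge>N. dist (\<sigma> m i) (\<sigma> n i) < e"
        unfolding dist_real_def by (metis mult_less_cancel_left_pos)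
    qed
    then show ?thesis by (simp add: F_def Cauchy_convergent_iff convergent_LIMSEQ_iff)
  qed
  have close: "\<exists>N. \<forall>n\<ge>N. \<forall>i. w i * \<bar>F i - \<sigma> n i\<bar> \<le> e" if "e > 0" for e
  proof -
    from Cauchy[OF that] obtain N where
      N: "\<And>m n i. m \<ge> N \<Longrightarrow> n \<ge> N \<Longrightarrow> w i * \<bar>\<sigma> m i - \<sigma> n i\<bar> < e" by blast
    have "w i * \<bar>F i - \<sigma> n i\<bar> \<le> e" if "n \<ge> N" for n i
    proof (rule LIMSEQ_le_const2)
      show "(\<lambda>m. w i * \<bar>\<sigma> m i - \<sigma> n i\<bar>) \<longlonglongrightarrow> w i * \<bar>F i - \<sigma> n i\<bar>"
        by (intro tendsto_intros lim)
      show "\<exists>N. \<forall>m\<ge>N. w i * \<bar>\<sigma> m i - \<sigma> n i\<bar> \<le> e" using N that by (metis less_imp_le)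
    qed
    then show ?thesis by blast
  qed
  have F: "F \<in> V"
  proof (rule uniform_limit_in_V)
    show "w i = 0 \<Longrightarrow> F i = 0" for i using off_weight[OF \<sigma>] by (simp add: F_def)
    show "\<exists>g\<in>V. \<forall>i. w i * \<bar>F i - g i\<bar> \<le> e" if "e > 0" for e
      using close[OF that] \<sigma> by blast
  qed
  have "\<exists>N. \<forall>n\<ge>N. ndist X (\<sigma> n) F < e" if "e > 0" for e
  proof -
    from close[of "e / 2"] that obtain N
      where N: "\<And>n i. n \<ge> N \<Longrightarrow> w i * \<bar>F i - \<sigma> n i\<bar> \<le> e / 2" by auto
    have "ndist X (\<sigma> n) F \<le> e / 2" if "n \<ge> N" for n
    proof -
      have "sup_norm w (\<lambda>i. F i - \<sigma> n i) \<le> e / 2"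
        unfolding norm_le_iff[OF diff_in_V[OF F \<sigma>]] using N[OF that] by blast
      then show ?thesis unfolding M.commute[of "\<sigma> n"] using F \<sigma> by (simp add: ndist_X)
    qed
    then have "ndist X (\<sigma> n) F < e" if "n \<ge> N" for n
      using that \<open>e > 0\<close> by fastforce
    then show ?thesis by blast
  qed
  then show "\<exists>F. limitin M.mtopology \<sigma> F sequentially"
    using F \<sigma> by (auto simp: M.limit_metric_sequentially)
qed

lemma banach_lattice_X: "banach_lattice X"
proof (rule banach_lattice.intro[OF vector_lattice_X], rule banach_lattice_axioms.intro)
  show "Metric_space.mcomplete (carrier X) (ndist X)" using mcomplete_X by simp
qed (auto simp: norm_ge_0 norm_zero_iff norm_scale norm_add norm_mono)

lemma separable_X: "separable_banach_lattice X"
proof -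
  have "M.mtopology closure_of lattice_span G = V"
  proof (unfold M.metric_closure_of_alt, intro equalityI subsetI CollectI conjI allI impI)
    fix f and e :: real assume f: "f \<in> V" and "e > 0"
    from approximable[OF this] obtain g
      where g: "g \<in> lattice_span G" "\<And>i. w i * \<bar>f i - g i\<bar> \<le> e" by blast
    have gV: "g \<in> V" using g(1) lattice_span_subset by blast
    then have "ndist X f g \<le> e" using g(2) f by (simp add: ndist_X norm_le_iff diff_in_V)
    with f g(1) gV show "\<exists>g\<in>lattice_span G. g \<in> M.mcball f e" by (auto simp: M.in_mcball)
  qed auto
  then have "separable_space M.mtopology"
    unfolding separable_space_def
    using countable_lattice_span[OF generators_countable] lattice_span_subset
    by (intro exI[of _ "lattice_span G"]) auto
  then show ?thesis
    by (simp add: separable_banach_lattice_def banach_lattice_X)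
qed

end


section \<open>A tree labelled by ordinals\<close>

text \<open>
  Nodes are lists of naturals in reversed order, the last step first, so that the ancestors of a
  node are its suffixes.  A node is a list all of whose proper ancestors have a label above \<open>bot\<close>.
  Functions on nodes are indexed by the codes of the lists.
\<close>

locale labelled_tree =
  fixes \<alpha> :: "'l::{wellorder, order_bot}"
  assumes countable_below: "countable {..<\<alpha>}"
begin

text \<open>
  Running maxima along an enumeration of the smaller labels: they stay below \<open>\<beta>\<close> and are
  eventually at least any given smaller label.  This treats successors and limits uniformly.
\<close>

definition child_label :: "'l \<Rightarrow> nat \<Rightarrow> 'l" where
  "child_label \<beta> n = Max (from_nat_into {..<\<beta>} ` {..n})"

primrec label :: "nat list \<Rightarrow> 'l" where
  "label [] = \<alpha>"
| "label (n # t) = child_label (label t) n"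

definition nodes :: "nat list set" where
  "nodes = {t. \<forall>s. strict_suffix s t \<longrightarrow> label s \<noteq> bot}"

definition leaves :: "nat list set" where
  "leaves = {t \<in> nodes. label t = bot}"

lemma below_nonempty: "\<beta> \<noteq> bot \<Longrightarrow> {..<\<beta>} \<noteq> {}" for \<beta> :: 'l
  using bot.not_eq_extremum by auto

lemma child_label_less:
  assumes "\<beta> \<noteq> bot"
  shows "child_label \<beta> n < \<beta>"
proof -
  have "child_label \<beta> n \<in> from_nat_into {..<\<beta>} ` {..n}"
    unfolding child_label_def by (rule Max_in) auto
  then show ?thesis using from_nat_into[OF below_nonempty[OF assms]] by auto
qed

lemma child_label_cofinal:
  assumes "\<gamma> < \<beta>" "\<beta> \<le> \<alpha>"
  shows "\<forall>\<^sub>F n in sequentially. \<gamma> \<le> child_label \<beta> n"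
proof -
  have "countable {..<\<beta>}" by (rule countable_subset[OF _ countable_below]) (use assms in auto)
  then obtain N where N: "from_nat_into {..<\<beta>} N = \<gamma>"
    using from_nat_into_surj[of "{..<\<beta>}" \<gamma>] assms(1) by auto
  have "\<gamma> \<le> child_label \<beta> n" if "n \<ge> N" for n
    unfolding child_label_def N[symmetric] using that by (intro Max_ge) auto
  then show ?thesis by (auto simp: eventually_sequentially)
qed

lemma Nil_in_nodes [simp]: "[] \<in> nodes"
  by (simp add: nodes_def)

lemma Cons_in_nodes [simp]: "n # t \<in> nodes \<longleftrightarrow> t \<in> nodes \<and> label t \<noteq> bot"
proof -
  have "strict_suffix s (n # t) \<longleftrightarrow> s = t \<or> strict_suffix s t" for s
    by (auto simp: strict_suffix_def suffix_Cons dest: suffix_length_le)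
  then show ?thesis by (auto simp: nodes_def)
qed

lemma label_le: "t \<in> nodes \<Longrightarrow> label t \<le> \<alpha>"
proof (induction t)
  case (Cons n t)
  then have "label t \<le> \<alpha>" "label t \<noteq> bot" by auto
  then show ?case using child_label_less[of "label t" n] by (simp add: less_imp_le order.strict_trans2)
qed simp

section \<open>The function lattice over the tree\<close>

definition char_fun :: "nat list set \<Rightarrow> nat \<Rightarrow> real" where
  "char_fun S i = of_bool (list_decode i \<in> S)"

definition weight :: "nat \<Rightarrow> real" where
  "weight i = (if list_decode i \<in> nodes then (1 / 3) ^ length (list_decode i) else 0)"

definition tail :: "nat \<Rightarrow> nat list set" where
  "tail n = {t \<in> nodes. label t \<noteq> bot \<or> n < list_encode t}"

definition above :: "'l list \<Rightarrow> nat list set" where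
  "above b = {t \<in> nodes. \<forall>s. suffix s t \<longrightarrow> length s < length b \<longrightarrow> b ! length s < label s}"

definition thresholds :: "'l list set" where
  "thresholds = {b. sorted_wrt (>) b \<and> set b \<subseteq> {..<\<alpha>}}"

definition pieces :: "nat list set set" where
  "pieces = (\<lambda>t. {t}) ` leaves \<union> range tail \<union> above ` thresholds"

lemma piece_subset_nodes: "S \<in> pieces \<Longrightarrow> S \<subseteq> nodes"
  by (auto simp: pieces_def leaves_def tail_def above_def)

lemma above_Cons:
  "n # t \<in> above b \<longleftrightarrow> t \<in> above b \<and> label t \<noteq> bot \<and>
    (Suc (length t) < length b \<longrightarrow> b ! Suc (length t) < label (n # t))"
  by (auto simp: above_def suffix_Cons)

text \<open>
  A set \<open>{l}\<close> or \<open>tail m\<close> differs at only finitely many children of an inner node from what it is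
  at that node.  For \<open>above b\<close>, a node \<open>t\<close> of the set has label greater than \<open>b ! |t|\<close>, hence
  all but finitely many of its children have a label of at least \<open>b ! |t|\<close>, which is strictly above the
  next threshold: this is where thresholds have to decrease.
\<close>

lemma piece_stable:
  assumes S: "S \<in> pieces" and t: "t \<in> nodes" "label t \<noteq> bot"
  shows "\<forall>\<^sub>F n in sequentially. n # t \<in> S \<longleftrightarrow> t \<in> S"
proof -
  have avoid: "\<forall>\<^sub>F n in sequentially. n # t \<notin> A" if "finite A" for A
  proof -
    have "finite ((\<lambda>n. n # t) -` A)" by (rule finite_vimageI[OF that]) (simp add: inj_def)
    then show ?thesis
      using eventually_cofinite[of "\<lambda>n. n # t \<notin> A"] by (simp add: cofinite_eq_sequentially vimage_def)
  qed
  from S consider l where "l \<in> leaves" "S = {l}" | m where "S = tail m"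
    | b where "b \<in> thresholds" "S = above b" by (auto simp: pieces_def)
  then show ?thesis
  proof cases
    case (1 l)
    then have "t \<notin> S" using t by (auto simp: leaves_def)
    then show ?thesis using avoid[of "{l}"] 1 by simp
  next
    case (2 m)
    have "finite (list_decode ` {..m})" by simp
    from avoid[OF this] show ?thesis
    proof eventually_elim
      case (elim n)
      have "m < list_encode (n # t)"
        using elim by (metis atMost_iff imageI list_encode_inverse not_le)
      then show ?case using t 2 by (simp add: tail_def)
    qed
  next
    case (3 b)
    show ?thesis
    proof (cases "t \<in> S \<and> Suc (length t) < length b")
      case True
      then have "b ! Suc (length t) < b ! length t"
        using 3 by (auto simp: thresholds_def sorted_wrt_iff_nth_less)
      moreover have "b ! length t < label t"
        using True 3 by (auto simp: above_def)
      ultimately show ?thesis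
        using child_label_cofinal[OF _ label_le[OF t(1)], of "b ! length t"] True 3 t
        by (auto simp: above_Cons elim!: eventually_mono)
    next
      case False
      then have "n # t \<in> S \<longleftrightarrow> t \<in> S" for n using 3 t by (auto simp: above_Cons)
      then show ?thesis by simp
    qed
  qed
qed

lemma countable_pieces: "countable pieces"
proof -
  have "thresholds \<subseteq> lists {..<\<alpha>}" by (auto simp: thresholds_def)
  then have "countable thresholds"
    using countable_below countable_lists countable_subset by blast
  then show ?thesis by (simp add: pieces_def)
qed

lemma weight_le_1: "weight i \<le> 1"
  by (simp add: weight_def power_le_one)

sublocale weighted_generators weight "char_fun ` pieces"
proof
  fix g assume "g \<in> char_fun ` pieces"
  then obtain S where S: "S \<in> pieces" "g = char_fun S" by blast
  show "g i = 0" if "weight i = 0" for i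
    using that piece_subset_nodes[OF S(1)] by (auto simp: S char_fun_def weight_def split: if_splits)
  show "\<exists>C. \<forall>i. weight i * \<bar>g i\<bar> \<le> C"
    using weight_le_1 by (intro exI[of _ 1]) (simp add: S char_fun_def)
qed (auto simp: weight_def countable_pieces)

lemma char_fun_in_V: "S \<in> pieces \<Longrightarrow> char_fun S \<in> V"
  using lattice_span_subset lattice_span.gen by blast

lemma lattice_span_branch_limit:
  assumes "g \<in> lattice_span (char_fun ` pieces)" "t \<in> nodes" "label t \<noteq> bot"
  shows "(\<lambda>n. g (list_encode (n # t))) \<longlonglongrightarrow> g (list_encode t)"
  using assms(1)
proof induction
  case (gen g)
  then obtain S where S: "S \<in> pieces" "g = char_fun S" by blast
  have "\<forall>\<^sub>F n in sequentially. g (list_encode (n # t)) = g (list_encode t)"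
    using piece_stable[OF S(1) assms(2,3)]
    by eventually_elim (simp only: S(2) char_fun_def list_encode_inverse)
  then show ?case by (rule tendsto_eventually)
qed (auto intro: tendsto_intros simp del: list_encode.simps)

text \<open>
  The weights of \<open>t\<close> and of all its children are bounded below by one positive constant, so an
  approximation in norm is uniform on this set of nodes.
\<close>

lemma branch_limit:
  assumes f: "f \<in> V" and t: "t \<in> nodes" "label t \<noteq> bot"
  shows "(\<lambda>n. f (list_encode (n # t))) \<longlonglongrightarrow> f (list_encode t)"
proof (rule tendstoI)
  fix e :: real assume e: "e > 0"
  define c :: real where "c = (1 / 3) ^ Suc (length t)"
  have c: "c > 0" by (simp add: c_def)
  with e have "c * (e / 3) > 0" by simp
  from approximable[OF f this] obtain g where g: "g \<in> lattice_span (char_fun ` pieces)"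
    "\<And>i. weight i * \<bar>f i - g i\<bar> \<le> c * (e / 3)" by blast
  have near: "\<bar>f (list_encode s) - g (list_encode s)\<bar> \<le> e / 3"
    if "s \<in> nodes" "length s \<le> Suc (length t)" for s
  proof -
    have "c \<le> weight (list_encode s)"
      using that(1) power_decreasing[OF that(2), of "1 / 3 :: real"]
      by (simp add: weight_def c_def del: power_Suc)
    then have "c * \<bar>f (list_encode s) - g (list_encode s)\<bar> \<le> c * (e / 3)"
      using g(2)[of "list_encode s"] by (meson abs_ge_zero mult_right_mono order_trans)
    then show ?thesis using c by simp
  qed
  from lattice_span_branch_limit[OF g(1) t] e
  have "\<forall>\<^sub>F n in sequentially. dist (g (list_encode (n # t))) (g (list_encode t)) < e / 3"
    by (intro tendstoD) simp_all
  then show "\<forall>\<^sub>F n in sequentially. dist (f (list_encode (n # t))) (f (list_encode t)) < e"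
  proof eventually_elim
    case (elim n)
    have "\<bar>f (list_encode t) - g (list_encode t)\<bar> \<le> e / 3"
      "\<bar>f (list_encode (n # t)) - g (list_encode (n # t))\<bar> \<le> e / 3"
      using near[of t] near[of "n # t"] t by (simp_all del: list_encode.simps)
    then show ?case using elim unfolding dist_real_def by argo
  qed
qed

text \<open>
  By \<open>branch_limit\<close>, positivity at an inner node passes to one of its children, whose label is
  smaller; this descent ends at a leaf.
\<close>

lemma positive_at_leaf:
  assumes f: "f \<in> V" and "f (list_encode t) > 0"
  shows "\<exists>l\<in>leaves. f (list_encode l) > 0"
  using assms(2)
proof (induction "label t" arbitrary: t rule: less_induct)
  case less
  have t: "t \<in> nodes"
  proof (rule ccontr)
    assume "t \<notin> nodes"
    then have "weight (list_encode t) = 0" by (simp add: weight_def)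
    from off_weight[OF f this] less.prems show False by simp
  qed
  show ?case
  proof (cases "label t = bot")
    case True
    then show ?thesis using t less.prems by (auto simp: leaves_def)
  next
    case False
    from order_tendstoD(1)[OF branch_limit[OF f t False] less.prems] obtain n
      where "f (list_encode (n # t)) > 0" by (auto simp: eventually_sequentially)
    moreover have "label (n # t) < label t" using child_label_less[OF False] by simp
    ultimately show ?thesis by (rule less.hyps[rotated])
  qed
qed

lemma leaf_in_pieces: "l \<in> leaves \<Longrightarrow> {l} \<in> pieces"
  by (simp add: pieces_def)

lemma nonpos_if_nonpos_at_leaves:
  assumes "f \<in> V" "\<And>l. l \<in> leaves \<Longrightarrow> f (list_encode l) \<le> 0"
  shows "f i \<le> 0"
  using positive_at_leaf[OF assms(1), of "list_decode i"] assms(2) by (force simp: not_le[symmetric])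

lemma pos_cone_X: "f \<in> pos_cone X - {\<zero>\<^bsub>X\<^esub>} \<longleftrightarrow> f \<in> V \<and> (\<forall>i. 0 \<le> f i) \<and> (\<exists>i. 0 < f i)"
  by (auto simp: pos_cone_def fun_eq_iff less_le)

lemma pi_basis: "has_countable_pi_basis X"
proof -
  define B where "B = (\<lambda>(l, n) i. char_fun {l} i / real (Suc n)) ` (leaves \<times> UNIV)"
  have pos: "b \<in> pos_cone X - {\<zero>\<^bsub>X\<^esub>}" if "b \<in> B" for b
  proof -
    from that obtain l n where l: "l \<in> leaves" "b = (\<lambda>i. (1 / real (Suc n)) * char_fun {l} i)"
      by (auto simp: B_def)
    have "b \<in> V" unfolding l(2) by (intro scale_in_V char_fun_in_V leaf_in_pieces l)
    moreover have "b (list_encode l) > 0" by (simp add: l char_fun_def)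
    moreover have "0 \<le> b i" for i by (simp add: l char_fun_def)
    ultimately show ?thesis unfolding pos_cone_X by blast
  qed
  have small: "\<exists>b\<in>B. b \<preceq>\<^bsub>X\<^esub> f" if "f \<in> pos_cone X - {\<zero>\<^bsub>X\<^esub>}" for f
  proof -
    from that obtain i where f: "f \<in> V" "\<And>i. f i \<ge> 0" "f i > 0" unfolding pos_cone_X by auto
    from positive_at_leaf[OF f(1), of "list_decode i"] f(3) obtain l
      where l: "l \<in> leaves" "f (list_encode l) > 0" by auto
    from l(2) obtain n where n: "1 / real (Suc n) < f (list_encode l)"
      using nat_approx_posE by blast
    have "char_fun {l} i / real (Suc n) \<le> f i" for i
      using n f(2)[of i] by (cases "list_decode i = l") (auto simp: char_fun_def)
    moreover have "(\<lambda>i. char_fun {l} i / real (Suc n)) \<in> B" using l by (auto simp: B_def)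
    ultimately show ?thesis by (intro bexI) auto
  qed
  \<comment> \<open>A leaf exists: otherwise the characteristic function of all nodes would not be positive.\<close>
  have "above [] \<in> pieces" by (auto simp: pieces_def thresholds_def)
  from positive_at_leaf[OF char_fun_in_V[OF this], of "[]"]
  have "B \<noteq> {}" by (auto simp: B_def char_fun_def above_def)
  moreover have "countable B" unfolding B_def by (intro countable_image countable_SIGMA) auto
  ultimately have "range (from_nat_into B) = B" by simp
  then show ?thesis unfolding has_countable_pi_basis_def
    using pos small by (intro exI[of _ "from_nat_into B"]) (metis rangeI rangeE)
qed

lemma tail_in_pieces: "tail n \<in> pieces"
  by (simp add: pieces_def)

lemma tails_decreasing: "(\<lambda>n. char_fun (tail n)) \<in> decreasing_seqs X"
  using char_fun_in_V[OF tail_in_pieces]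
  by (auto simp: decreasing_seqs_def pos_cone_def char_fun_def tail_def)

text \<open>
  Every leaf is missing from some tail, so a lower bound is nonpositive at all leaves and hence
  everywhere.
\<close>

lemma tails_infimum:
  "greatest (ord_of X) \<zero>\<^bsub>X\<^esub> (Lower (ord_of X) (range (\<lambda>n. char_fun (tail n))))"
proof -
  have "f i \<le> 0" if f: "f \<in> V" and le: "\<And>n i. f i \<le> char_fun (tail n) i" for f i
  proof (rule nonpos_if_nonpos_at_leaves[OF f])
    fix l assume "l \<in> leaves"
    then show "f (list_encode l) \<le> 0"
      using le[of "list_encode l" "list_encode l"] by (simp add: char_fun_def tail_def leaves_def)
  qed
  then have "\<forall>f\<in>Lower (ord_of X) (range (\<lambda>n. char_fun (tail n))). \<forall>i. f i \<le> 0"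
    unfolding Lower_def using char_fun_in_V[OF tail_in_pieces] by simp
  moreover have "(\<lambda>i. 0) \<in> Lower (ord_of X) (range (\<lambda>n. char_fun (tail n)))"
    using zero_in_V by (auto simp: Lower_def char_fun_def)
  ultimately show ?thesis by (auto simp: greatest_def Lower_def)
qed

section \<open>Strings of large rank\<close>

definition threshold_string :: "'l list \<Rightarrow> (nat \<Rightarrow> real) list" where
  "threshold_string b = map (\<lambda>i. char_fun (above (take (Suc i) b))) [0..<length b]"

lemma thresholds_below: "b \<in> thresholds \<Longrightarrow> \<beta> \<in> set b \<Longrightarrow> \<beta> < \<alpha>"
  by (auto simp: thresholds_def)

lemma take_thresholds: "b \<in> thresholds \<Longrightarrow> take i b \<in> thresholds"
  by (auto simp: thresholds_def sorted_wrt_take dest: in_set_takeD)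

text \<open>
  The functions to be estimated are bounded by \<open>1\<close> and live at depth at least \<open>i\<close>, where the
  weight is at most \<open>3\<^sup>-\<^sup>i\<close>.  For the comparison with \<open>z n\<close> this holds since a node of smaller
  depth in \<open>above (take i b)\<close> has a label above some threshold, so it is no leaf.  Consecutive
  entries are separated by the threshold \<open>b ! i\<close> alone, which tests ancestors of length \<open>i\<close>.
\<close>

lemma threshold_string_in_tree:
  assumes b: "b \<in> thresholds"
  shows "threshold_string b \<in> fatou_tree X (\<lambda>n. char_fun (tail n))"
proof -
  define y where "y i = char_fun (above (take i b))" for i
  have yV: "y i \<in> V" for i
    unfolding y_def using take_thresholds[OF b] by (intro char_fun_in_V) (auto simp: pieces_def)
  have nth: "threshold_string b ! (i - 1) = y i" if "1 \<le> i" "i \<le> length b" for i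
    using that by (cases i) (simp_all add: threshold_string_def y_def)
  \<comment> \<open>Index \<open>0\<close> is the code of the root, which has weight \<open>1\<close>.\<close>
  have root: "y i 0 = 1" for i
    using thresholds_below[OF b nth_mem, of 0] by (auto simp: y_def char_fun_def above_def)
  have norm: "1 \<le> sup_norm weight (y i)" for i
    using weighted_le_norm[OF yV, of 0 i] root by (simp add: weight_def)
  have small: "sup_norm weight f \<le> sup_norm weight (y i) / 3 ^ i"
    if "f \<in> V" "\<And>t. \<bar>f (list_encode t)\<bar> \<le> of_bool (t \<in> nodes \<and> i \<le> length t)" for f i
  proof -
    have "weight j * \<bar>f j\<bar> \<le> (1 / 3) ^ i" for j
    proof (cases "list_decode j \<in> nodes \<and> i \<le> length (list_decode j)")
      case True
      then have "weight j * \<bar>f j\<bar> \<le> (1 / 3) ^ length (list_decode j) * 1"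
        using that(2)[of "list_decode j"] by (intro mult_mono) (auto simp: weight_def)
      also have "\<dots> \<le> (1 / 3) ^ i" using True by (simp add: power_decreasing)
      finally show ?thesis .
    next
      case False
      with that(2)[of "list_decode j"] have "f j = 0" by auto
      then show ?thesis by simp
    qed
    then have "sup_norm weight f \<le> (1 / 3) ^ i" using that(1) by (simp add: norm_le_iff)
    also have "\<dots> \<le> sup_norm weight (y i) / 3 ^ i"
      using norm[of i] by (simp add: power_one_over divide_right_mono)
    finally show ?thesis .
  qed
  have "\<parallel>pos_part X (y i \<ominus>\<^bsub>X\<^esub> char_fun (tail n))\<parallel>\<^bsub>X\<^esub> \<le> \<parallel>y i\<parallel>\<^bsub>X\<^esub> / 3 ^ i"
    if i: "1 \<le> i" "i \<le> length b" for i n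
  proof -
    have diff: "(\<lambda>j. y i j - char_fun (tail n) j) \<in> V"
      by (intro diff_in_V yV char_fun_in_V tail_in_pieces)
    have "sup_norm weight (\<lambda>j. max (y i j - char_fun (tail n) j) 0) \<le> sup_norm weight (y i) / 3 ^ i"
    proof (rule small)
      show "(\<lambda>j. max (y i j - char_fun (tail n) j) 0) \<in> V" by (intro max_in_V diff zero_in_V)
      fix t
      have "i \<le> length t" if "t \<in> above (take i b)" "t \<notin> tail n"
      proof (rule ccontr)
        assume "\<not> i \<le> length t"
        then have "b ! length t < label t" using that(1) i by (auto simp: above_def)
        moreover have "label t = bot" using that by (auto simp: above_def tail_def)
        ultimately show False by simp
      qed
      then show "\<bar>max (y i (list_encode t) - char_fun (tail n) (list_encode t)) 0\<bar>
          \<le> of_bool (t \<in> nodes \<and> i \<le> length t)"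
        by (auto simp: y_def char_fun_def above_def)
    qed
    then show ?thesis using diff yV char_fun_in_V[OF tail_in_pieces] by (simp add: minus_X)
  qed
  moreover have "\<parallel>y (Suc i) \<ominus>\<^bsub>X\<^esub> y i\<parallel>\<^bsub>X\<^esub> \<le> \<parallel>y i\<parallel>\<^bsub>X\<^esub> / 3 ^ i"
    if i: "1 \<le> i" "i < length b" for i
  proof -
    have "sup_norm weight (\<lambda>j. y (Suc i) j - y i j) \<le> sup_norm weight (y i) / 3 ^ i"
    proof (rule small)
      show "(\<lambda>j. y (Suc i) j - y i j) \<in> V" by (intro diff_in_V yV)
      fix t
      have "above (take (Suc i) b) \<subseteq> above (take i b)" by (auto simp: above_def)
      moreover have "i \<le> length t" if t: "t \<in> above (take i b)" "t \<notin> above (take (Suc i) b)"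
      proof -
        from t obtain s where s: "suffix s t" "length s < Suc i" "\<not> b ! length s < label s"
          by (auto simp: above_def)
        with t(1) i have "\<not> length s < i" by (auto simp: above_def)
        with s show ?thesis using suffix_length_le[of s t] by simp
      qed
      ultimately show "\<bar>y (Suc i) (list_encode t) - y i (list_encode t)\<bar>
          \<le> of_bool (t \<in> nodes \<and> i \<le> length t)"
        by (auto simp: y_def char_fun_def above_def)
    qed
    then show ?thesis using yV by (simp add: minus_X)
  qed
  moreover have "set (threshold_string b) \<subseteq> pos_cone X - {\<zero>\<^bsub>X\<^esub>}"
  proof
    fix f assume "f \<in> set (threshold_string b)"
    then obtain i where f: "f = y i" by (auto simp: threshold_string_def y_def)
    have "\<exists>j. 0 < y i j" using root by (metis zero_less_one)
    then show "f \<in> pos_cone X - {\<zero>\<^bsub>X\<^esub>}"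
      unfolding pos_cone_X f using yV by (auto simp: y_def char_fun_def)
  qed
  moreover have "length (threshold_string b) = length b" by (simp add: threshold_string_def)
  moreover have "threshold_string b ! i = y (Suc i)" if "i < length b" for i
    using nth[of "Suc i"] that by simp
  ultimately show ?thesis
    unfolding fatou_tree_def using nth by (auto simp del: span_lattice_simps)
qed

lemma threshold_string_snoc:
  "threshold_string (b @ [\<gamma>]) = threshold_string b @ [char_fun (above (b @ [\<gamma>]))]"
  by (simp add: threshold_string_def)

end

text \<open>
  If the rank were smaller than \<open>\<beta>\<close>, some extension would have at least the same rank, while
  ranks drop strictly along extensions.
\<close>

lemma rank_at_ge:
  fixes T :: "'a list set"
  assumes T: "is_tree T" "\<not> ill_founded T" and s: "s \<in> T"
    and step: "\<And>\<gamma>. \<gamma> < \<beta> \<Longrightarrow> \<exists>t\<in>extensions T s. \<gamma> \<le> rank_at T t"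
  shows "\<beta> \<le> rank_at T s"
proof (rule ccontr)
  assume "\<not> \<beta> \<le> rank_at T s"
  then obtain t where t: "t \<in> extensions T s" "rank_at T s \<le> rank_at T t"
    using step[of "rank_at T s"] not_le by blast
  have "rank_at T t < ord_suc (rank_at T t)" by (rule less_ord_suc) (rule infinite_UNIV_listI)
  also have "\<dots> \<le> rank_at T s"
    unfolding rank_at_eq[OF T s] using t(1) by (auto intro!: cSUP_upper bdd_above_rank)
  finally show False using t(2) by simp
qed

theorem theorem1p3:
  fixes \<alpha> :: "(nat \<Rightarrow> real) list ordinal"
  assumes "countable {..<\<alpha>}"
  shows "\<exists>X :: (nat \<Rightarrow> real) normed_lattice.
    separable_banach_lattice X \<and> has_countable_pi_basis X \<and> \<not> alpha_fatou \<alpha> X"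
proof -
  interpret labelled_tree \<alpha> by standard (rule assms)
  let ?z = "\<lambda>n. char_fun (tail n)"
  let ?T = "fatou_tree X ?z"
  \<comment> \<open>Consing \<open>\<alpha>\<close> covers the empty string as well, whose continuations are all ordinals below \<open>\<alpha>\<close>.\<close>
  have rank: "last (\<alpha> # b) \<le> rank_at ?T (threshold_string b)"
    if "\<not> ill_founded ?T" "b \<in> thresholds" for b
    using that(2)
  proof (induction "last (\<alpha> # b)" arbitrary: b rule: less_induct)
    case less
    show ?case
    proof (rule rank_at_ge[OF is_tree_fatou_tree that(1) threshold_string_in_tree[OF less.prems]])
      fix \<gamma> assume \<gamma>: "\<gamma> < last (\<alpha> # b)"
      have "\<gamma> < \<beta>" if "\<beta> \<in> set b" for \<beta>
      proof -
        have "last b \<le> \<beta>"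
          using that less.prems by (induction b) (auto simp: thresholds_def intro: less_imp_le)
        then show ?thesis using \<gamma> that by (cases "b = []") auto
      qed
      moreover have "\<gamma> < \<alpha>"
        using \<gamma> thresholds_below[OF less.prems last_in_set] by (cases "b = []") auto
      ultimately have b': "b @ [\<gamma>] \<in> thresholds"
        using less.prems by (auto simp: thresholds_def sorted_wrt_append)
      have "\<gamma> \<le> rank_at ?T (threshold_string (b @ [\<gamma>]))"
        using less.hyps[OF _ b'] \<gamma> by simp
      moreover have "threshold_string (b @ [\<gamma>]) \<in> extensions ?T (threshold_string b)"
        using threshold_string_in_tree[OF b']
        by (simp add: extensions_def threshold_string_snoc strict_prefix_def)
      ultimately show "\<exists>t\<in>extensions ?T (threshold_string b). \<gamma> \<le> rank_at ?T t" by blast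
    qed
  qed
  have "\<not> tree_rank ?T \<le> Fin \<alpha>"
  proof (cases "ill_founded ?T")
    case False
    have "\<alpha> \<le> rank_at ?T []"
      using rank[OF False, of "[]"] by (simp add: thresholds_def threshold_string_def)
    also have "\<dots> < ord_suc (rank_at ?T [])" by (rule less_ord_suc) (rule infinite_UNIV_listI)
    finally show ?thesis using False by (simp add: tree_rank_def)
  qed (simp add: tree_rank_def)
  then have "\<not> alpha_fatou \<alpha> X"
    unfolding alpha_fatou_def using tails_decreasing tails_infimum by blast
  then show ?thesis using separable_X pi_basis by blast
qed

end
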